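(* Let $d$ and $n$ be any positive integers such that $2d<n$. Then for every admissible pinnacle set $S\subseteq[n]$ with $|S|=d$, $$2^{n-d-1}\;\le\; p_S(n)\;\le\; d!\cdot (d+1)!\cdot 2^{n-2d-1}\cdot S(n-d,d+1),$$ where $S(\cdot,\cdot)$ denotes the Stirling number of the second kind. Both bounds are tight: for each such $d$ and $n$ there is an admissible pinnacle set $S\subseteq [n]$ with $|S|=d$ attaining equality in the upper bound, and there is an admissible pinnacle set $S\subseteq[n]$ with $|S|=d$ attaining equality in the lower bound.
   Context: Let $[n]=\{1,2,\ldots,n\}$ and let $S_n$ be the set of permutations of $[n]$, written as words $w=w(1)w(2)\cdots w(n)$. A pinnacle of $w\in S_n$ is a value $w(i)$ with $2\le i\le n-1$ and $w(i-1)<w(i)>w(i+1)$. The pinnacle set $\mathrm{Pin}(w)$ is the set of all pinnacles of $w$. A set $S$ is an admissible pinnacle set if $S=\mathrm{Pin}(w)$ for some $w\in S_k$ and some $k\ge1$. For a set $S$, $p_S(n)=|\{w\in S_n:\mathrm{Pin}(w)=S\}|$. The Stirling number of the second kind $S(a,b)$ is the number of partitions of an $a$-element set into $b$ nonempty blocks (this two-argument notation is unrelated to the pinnacle set $S$). *)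

theory Defs
  imports
    "HOL-Combinatorics.Combinatorics"
    "HOL-Library.Disjoint_Sets"
begin

text \<open>
  A word \<open>w(1) \<dots> w(n)\<close> in \<open>S\<^sub>n\<close> is represented by the function \<open>w\<close> with
  \<open>w permutes {1..n}\<close>. Such a \<open>w\<close> is the identity outside \<open>{1..n}\<close>, so each
  permutation has exactly one representative. The length \<open>n\<close> is an explicit argument of
  \<open>Pin\<close>, since the function alone does not determine it.
\<close>

definition Pin :: "nat \<Rightarrow> (nat \<Rightarrow> nat) \<Rightarrow> nat set" where
  "Pin n w = {w i | i. 2 \<le> i \<and> i \<le> n - 1 \<and> w (i - 1) < w i \<and> w i > w (i + 1)}"

definition admissible_pinnacle_set :: "nat set \<Rightarrow> bool" where
  "admissible_pinnacle_set S \<longleftrightarrow> (\<exists>k\<ge>1. \<exists>w. w permutes {1..k} \<and> Pin k w = S)"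

definition pinnacle_count :: "nat set \<Rightarrow> nat \<Rightarrow> nat" where
  "pinnacle_count S n = card {w. w permutes {1..n} \<and> Pin n w = S}"

text \<open>
  The library defines \<^const>\<open>Stirling\<close> by its recurrence; the following shows that it counts
  set partitions.
\<close>

lemma card_partitions_eq_Stirling:
  assumes "finite A"
  shows "card {P. partition_on A P \<and> card P = k} = Stirling (card A) k"
  using assms
proof (induction A arbitrary: k rule: finite_induct)
  case empty
  have "{P. partition_on ({}::'a set) P \<and> card P = k} = (if k = 0 then {{}} else {})"
    by (auto simp: partition_on_empty)
  then show ?case by (cases k) (simp_all del: Collect_empty_eq)
next
  case (insert x A)
  define R where "R = (\<lambda>k. {P. partition_on A P \<and> card P = k})"
  have R: "card (R k) = Stirling (card A) k" for k
    using insert.IH by (simp add: R_def)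
  have finR: "finite (R k)" for k
    unfolding R_def by (rule finite_subset[OF _ finitely_many_partition_on[OF insert.hyps(1)]]) auto
  show ?case
  proof (cases k)
    case 0
    have "P \<noteq> {} \<and> finite P" if "partition_on (insert x A) P" for P
      using that finite_elements[of "insert x A" P] insert.hyps(1)
      by (auto simp: partition_on_def)
    then have "{P. partition_on (insert x A) P \<and> card P = k} = {}"
      using 0 by (metis (mono_tags, lifting) card_0_eq empty_Collect_eq)
    then show ?thesis using 0 insert.hyps by (simp del: Collect_empty_eq)
  next
    case (Suc m)
    define F :: "('a set set \<times> 'a set) \<Rightarrow> 'a set set"
      where "F = (\<lambda>(P, B). insert (insert x B) (P - {B}))"
    define D where "D = (SIGMA P:R (Suc m). P)"
    define T where "T = {P. partition_on (insert x A) P \<and> card P = Suc m}"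
    have nx: "x \<notin> C" if "P \<in> R j" "C \<in> P" for P C j
      using that insert.hyps(2) by (auto simp: R_def partition_on_def)
    have finP: "finite P" if "P \<in> R j" for P j
      using that finite_elements[OF insert.hyps(1)] by (auto simp: R_def)
    have T1: "F ` D \<subseteq> T"
    proof (clarsimp simp: D_def)
      fix P B assume PB: "P \<in> R (Suc m)" "B \<in> P"
      have U: "\<Union>P = A" "disjoint P" "{} \<notin> P" "card P = Suc m"
        using PB(1) by (auto simp: R_def partition_on_def)
      have "partition_on (insert x A) (F (P, B))"
      proof (rule partition_onI)
        show "\<Union> (F (P, B)) = insert x A" using U(1) PB(2) by (auto simp: F_def)
        show "{} \<notin> F (P, B)" using U(3) by (auto simp: F_def)
        fix p q assume "p \<in> F (P, B)" "q \<in> F (P, B)" "p \<noteq> q"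
        then show "disjnt p q"
          using U(2) PB nx[OF PB(1)]
          by (auto simp: F_def disjnt_def pairwise_def)
      qed
      moreover have "insert x B \<notin> P" using nx[OF PB(1)] by blast
      then have "card (F (P, B)) = Suc m"
        using U(4) PB(2) finP[OF PB(1)] by (simp add: F_def)
      ultimately show "F (P, B) \<in> T" by (simp add: T_def)
    qed
    have T2: "insert {x} ` R m \<subseteq> T"
    proof clarsimp
      fix P assume P: "P \<in> R m"
      have U: "\<Union>P = A" "disjoint P" "{} \<notin> P" "card P = m"
        using P by (auto simp: R_def partition_on_def)
      have "partition_on (insert x A) (insert {x} P)"
      proof (rule partition_onI)
        show "\<Union> (insert {x} P) = insert x A" using U(1) by auto
        show "{} \<notin> insert {x} P" using U(3) by auto
        fix p q assume "p \<in> insert {x} P" "q \<in> insert {x} P" "p \<noteq> q"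
        then show "disjnt p q" using U(2) nx[OF P] by (auto simp: disjnt_def pairwise_def)
      qed
      moreover have "{x} \<notin> P" using nx[OF P] by blast
      then have "card (insert {x} P) = Suc m" using U(4) finP[OF P] by simp
      ultimately show "insert {x} P \<in> T" by (simp add: T_def)
    qed
    have T3: "T \<subseteq> F ` D \<union> insert {x} ` R m"
    proof
      fix Q assume "Q \<in> T"
      then have Q: "\<Union>Q = insert x A" "disjoint Q" "{} \<notin> Q" "card Q = Suc m"
        by (auto simp: T_def partition_on_def)
      have finQ: "finite Q" using Q(4) card.infinite by fastforce
      obtain C where C: "C \<in> Q" "x \<in> C" using Q(1) by blast
      have dj: "disjnt p q" if "p \<in> Q" "q \<in> Q" "p \<noteq> q" for p q
        using that Q(2) by (auto simp: pairwise_def)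
      have xo: "x \<notin> E" if "E \<in> Q" "E \<noteq> C" for E
        using dj[OF that(1) C(1) that(2)] C(2) by (auto simp: disjnt_def)
      show "Q \<in> F ` D \<union> insert {x} ` R m"
      proof (cases "C = {x}")
        case True
        have "partition_on A (Q - {C})"
        proof (rule partition_onI)
          have "\<Union> (Q - {C}) = \<Union>Q - {x}" using True xo by blast
          then show "\<Union> (Q - {C}) = A" using Q(1) insert.hyps(2) by simp
        qed (use Q(3) dj in auto)
        moreover have "card (Q - {C}) = m" using Q(4) C(1) finQ by simp
        ultimately have "Q - {C} \<in> R m" by (simp add: R_def)
        moreover have "Q = insert {x} (Q - {C})" using C(1) True by blast
        ultimately show ?thesis by blast
      next
        case False
        define B where "B = C - {x}"
        define P where "P = insert B (Q - {C})"
        have BC: "insert x B = C" using C(2) by (auto simp: B_def)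
        have Bne: "B \<noteq> {}" using False BC by auto
        have Bd: "disjnt B E" if "E \<in> Q" "E \<noteq> C" for E
          using dj[OF that(1) C(1) that(2)] by (auto simp: disjnt_def B_def)
        have BQ: "B \<notin> Q"
        proof
          assume "B \<in> Q"
          moreover have "B \<noteq> C" using C(2) by (auto simp: B_def)
          ultimately have "disjnt B B" by (rule Bd)
          then show False using Bne by (simp add: disjnt_def)
        qed
        have "partition_on A P"
        proof (rule partition_onI)
          have "\<Union> P = \<Union>Q - {x}" using C xo unfolding P_def B_def by blast
          then show "\<Union> P = A" using Q(1) insert.hyps(2) by simp
          show "{} \<notin> P" using Bne Q(3) by (auto simp: P_def)
          fix p q assume "p \<in> P" "q \<in> P" "p \<noteq> q"
          then show "disjnt p q"
            using dj Bd disjnt_sym unfolding P_def by (metis DiffE insert_iff)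
        qed
        moreover have "card P = Suc m"
          using Q(4) C(1) finQ BQ by (simp add: P_def)
        ultimately have "(P, B) \<in> D" by (simp add: D_def R_def P_def)
        moreover have "P - {B} = Q - {C}" using BQ by (auto simp: P_def)
        then have "Q = F (P, B)" using BC C(1) by (auto simp: F_def)
        ultimately show ?thesis by blast
      qed
    qed
    have injF: "inj_on F D"
    proof (rule inj_onI, clarify)
      fix P B P' B'
      assume "(P, B) \<in> D" "(P', B') \<in> D" and eq: "F (P, B) = F (P', B')"
      then have a: "P \<in> R (Suc m)" "B \<in> P" "P' \<in> R (Suc m)" "B' \<in> P'"
        by (auto simp: D_def)
      have e: "insert (insert x B) (P - {B}) = insert (insert x B') (P' - {B'})"
        using eq by (simp add: F_def)
      have xP: "\<And>C. C \<in> P \<Longrightarrow> x \<notin> C" and xP': "\<And>C. C \<in> P' \<Longrightarrow> x \<notin> C"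
        using nx a by blast+
      have "insert x B \<in> insert (insert x B') (P' - {B'})" using e by blast
      then have "insert x B = insert x B'" using xP' by blast
      then have BB: "B = B'" using xP[OF a(2)] xP'[OF a(4)] by (metis insert_ident)
      have "insert x B \<notin> P - {B}" "insert x B \<notin> P' - {B}" using xP xP' by blast+
      then have "P - {B} = P' - {B}" using e unfolding BB by (metis insert_ident)
      then show "P = P' \<and> B = B'" using a BB by blast
    qed
    have injI: "inj_on (insert {x}) (R m)"
    proof (rule inj_onI)
      fix P P' assume "P \<in> R m" "P' \<in> R m" "insert {x} P = insert {x} P'"
      moreover from this have "{x} \<notin> P" "{x} \<notin> P'" using nx by blast+
      ultimately show "P = P'" by (metis insert_ident)
    qed
    have dis: "F ` D \<inter> insert {x} ` R m = {}"
    proof -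
      have False if h: "(P, B) \<in> D" "P' \<in> R m" "F (P, B) = insert {x} P'" for P B P'
      proof -
        have a: "P \<in> R (Suc m)" "B \<in> P" using h(1) by (auto simp: D_def)
        have "insert x B \<in> insert {x} P'" using h(3) by (auto simp: F_def)
        then have "insert x B = {x}" using nx[OF h(2)] by blast
        then have "B = {}" using nx[OF a] by blast
        then show False using a by (auto simp: R_def partition_on_def)
      qed
      then show ?thesis by fastforce
    qed
    have "T = F ` D \<union> insert {x} ` R m" using T1 T2 T3 by blast
    moreover have finD: "finite D" using finR finP by (auto simp: D_def)
    ultimately have "card T = card (F ` D) + card (insert {x} ` R m)"
      using dis finR by (simp add: card_Un_disjoint)
    also have "\<dots> = card D + card (R m)" using injF injI by (simp add: card_image)
    also have "card D = (\<Sum>P\<in>R (Suc m). card P)"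
      unfolding D_def using finR finP by (simp add: card_SigmaI)
    also have "\<dots> = (\<Sum>P\<in>R (Suc m). Suc m)" by (rule sum.cong) (auto simp: R_def)
    also have "\<dots> = Suc m * Stirling (card A) (Suc m)" using R by simp
    finally show ?thesis
      using R insert.hyps Suc by (simp add: T_def)
  qed
qed

end

theory Submission
  imports Defs
begin

text \<open>
  Insert the letters \<open>1, 2, \<dots>, n\<close> of a word in increasing order. After \<open>v\<close> steps the letters present
  form \<open>b\<close> unordered fragments of the final word. The next letter either starts a new
  fragment (one way), or extends a fragment at one of its two ends (\<open>2 b\<close> ways), or joins two fragments
  (\<open>b (b - 1)\<close> ways); it is a pinnacle exactly in the last case. So \<open>p\<^sub>S(n)\<close> is obtained from the
  state ``no fragments'' by applying the operator \<open>merge\<close> for letters in \<open>S\<close> and \<open>grow\<close> for the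
  others, and reading off the entry for a single fragment.

  Since \<open>grow \<circ> merge \<le> merge \<circ> grow\<close>, the count is largest when all pinnacles come last, where
  the powers of \<open>grow\<close> produce the Stirling numbers. For the lower bound, after \<open>v\<close> steps of which
  \<open>k\<close> were merges, an admissible \<open>S\<close> has at least \<open>2\<^bsup>v-k-b\<^esup>\<close> configurations with \<open>b\<close> fragments whenever
  \<open>1 \<le> b \<le> v - 2 k\<close>; equality holds for \<open>S = {3, 5, \<dots>, 2 d + 1}\<close>.
\<close>

section \<open>Pinnacles of lists and the insertion of a largest letter\<close>

fun peaks :: "nat list \<Rightarrow> nat set" where
  "peaks (x # y # z # xs) = (if x < y \<and> z < y then {y} else {}) \<union> peaks (y # z # xs)"
| "peaks _ = {}"

lemma peaks_conv_nth:
  "peaks xs = {xs ! i | i. 0 < i \<and> Suc i < length xs \<and> xs ! (i - 1) < xs ! i \<and> xs ! Suc i < xs ! i}"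
proof (induction xs rule: peaks.induct)
  case (1 x y z xs)
  let ?P = "\<lambda>xs i. 0 < i \<and> Suc i < length xs \<and> xs ! (i - 1) < xs ! i \<and> xs ! Suc i < xs ! i"
  have P: "?P (x # y # z # xs) (Suc i) \<longleftrightarrow> (i = 0 \<and> x < y \<and> z < y) \<or> ?P (y # z # xs) i" for i
    by (cases i) simp_all
  have "{(x # y # z # xs) ! i | i. ?P (x # y # z # xs) i}
      = {(x # y # z # xs) ! Suc i | i. ?P (x # y # z # xs) (Suc i)}"
    by (safe; metis Suc_pred)
  also have "\<dots> = (if x < y \<and> z < y then {y} else {}) \<union> {(y # z # xs) ! i | i. ?P (y # z # xs) i}"
    unfolding P by (auto intro: exI[of _ 0])
  finally show ?case using 1 by simp
qed auto

lemma peaks_subset: "peaks xs \<subseteq> set xs"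
  by (induction xs rule: peaks.induct) auto

lemma peaks_Cons_greater:
  assumes "\<forall>x\<in>set r. x < v"
  shows "peaks (v # r) = peaks r"
  using assms by (cases r rule: peaks.cases) auto

text \<open>The last letter of \<open>l\<close> and the first of \<open>r\<close> are ends before
  the insertion and neighbours of the larger \<open>v\<close> after it, so they are peaks in neither
  word. All other letters keep their neighbours, and \<open>v\<close> is a peak exactly when it has
  two.\<close>

lemma peaks_append_greater:
  assumes "\<forall>x\<in>set l. x < v" "\<forall>x\<in>set r. x < v"
  shows "peaks (l @ v # r) = peaks l \<union> peaks r \<union> (if l \<noteq> [] \<and> r \<noteq> [] then {v} else {})"
  using assms
proof (induction l rule: peaks.induct)
  case (1 x y z xs)
  then show ?case by auto
next
  case "2_1"
  then show ?case by (simp add: peaks_Cons_greater)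
next
  case ("2_2" x)
  then show ?case by (cases r) (auto simp: peaks_Cons_greater[of "_ # _"])
next
  case ("2_3" x y)
  then show ?case by (cases r) (auto simp: peaks_Cons_greater[of "_ # _"])
qed

section \<open>Permutations as words\<close>

text \<open>The inverse is the identity outside \<open>{1..n}\<close>, the only choice that
  \<open>permutes\<close> allows; so the word determines the function.\<close>

lemma bij_betw_permutes_lists:
  "bij_betw (\<lambda>w. map w [1..<Suc n]) {w. w permutes {1..n}} {xs. distinct xs \<and> set xs = {1..n}}"
proof (rule bij_betw_byWitness[where f' = "\<lambda>xs i. if i \<in> {1..n} then xs ! (i - 1) else i"])
  have len: "length xs = n" if "distinct xs" "set xs = {1..n}" for xs
    using that distinct_card by fastforce
  show "\<forall>w\<in>{w. w permutes {1..n}}.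
      (\<lambda>i. if i \<in> {1..n} then map w [1..<Suc n] ! (i - 1) else i) = w"
    by (auto simp: fun_eq_iff permutes_def simp del: upt_Suc)
  show "\<forall>xs\<in>{xs. distinct xs \<and> set xs = {1..n}}.
      map (\<lambda>i. if i \<in> {1..n} then xs ! (i - 1) else i) [1..<Suc n] = xs"
    by (auto intro!: nth_equalityI simp: len simp del: upt_Suc)
  show "(\<lambda>w. map w [1..<Suc n]) ` {w. w permutes {1..n}} \<subseteq> {xs. distinct xs \<and> set xs = {1..n}}"
    by (auto simp: distinct_map permutes_inj_on permutes_image atLeastLessThanSuc_atLeastAtMost
        simp del: upt_Suc)
  show "(\<lambda>xs i. if i \<in> {1..n} then xs ! (i - 1) else i) ` {xs. distinct xs \<and> set xs = {1..n}}
      \<subseteq> {w. w permutes {1..n}}"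
  proof clarify
    fix xs :: "nat list" assume xs: "distinct xs" "set xs = {1..n}"
    have "bij_betw (\<lambda>i. if i \<in> {1..n} then xs ! (i - 1) else i) {1..n} {1..n}"
    proof -
      have "bij_betw (\<lambda>i. i - 1) {1..n} {..<n}"
        by (rule bij_betw_byWitness[where f' = Suc]) auto
      moreover have "bij_betw ((!) xs) {..<n} {1..n}"
        using xs len[OF xs] by (auto intro!: bij_betw_nth)
      ultimately have "bij_betw ((!) xs \<circ> (\<lambda>i. i - 1)) {1..n} {1..n}"
        by (rule bij_betw_trans)
      then show ?thesis by (subst bij_betw_cong[where g = "(!) xs \<circ> (\<lambda>i. i - 1)"]) auto
    qed
    then show "(\<lambda>i. if i \<in> {1..n} then xs ! (i - 1) else i) permutes {1..n}"
      by (rule bij_imp_permutes) auto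
  qed
qed

lemma Pin_conv_peaks: "Pin n w = peaks (map w [1..<Suc n])"
proof -
  \<comment> \<open>Positions in \<open>w\<close> start at 1 and list indices at 0; after the shift
    \<open>i\<close> is the list index.\<close>
  have "Pin n w = {w (Suc i) | i. 0 < i \<and> Suc i < n \<and> w i < w (Suc i) \<and> w (Suc (Suc i)) < w (Suc i)}"
    unfolding Pin_def
  proof (intro Collect_cong iffI; elim exE conjE)
    fix x i assume "x = w i" "2 \<le> i" "i \<le> n - 1" "w (i - 1) < w i" "w (i + 1) < w i"
    then show "\<exists>i. x = w (Suc i) \<and> 0 < i \<and> Suc i < n \<and> w i < w (Suc i) \<and> w (Suc (Suc i)) < w (Suc i)"
      by (intro exI[of _ "i - 1"]) auto
  next
    fix x i assume "x = w (Suc i)" "0 < i" "Suc i < n" "w i < w (Suc i)" "w (Suc (Suc i)) < w (Suc i)"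
    then show "\<exists>i. x = w i \<and> 2 \<le> i \<and> i \<le> n - 1 \<and> w (i - 1) < w i \<and> w (i + 1) < w i"
      by (intro exI[of _ "Suc i"]) auto
  qed
  also have "\<dots> = peaks (map w [1..<Suc n])"
    unfolding peaks_conv_nth by (intro Collect_cong ex_cong1) (auto simp del: upt_Suc)
  finally show ?thesis .
qed

section \<open>Fragment configurations\<close>

text \<open>
  The fragments left of a word after erasing the letters larger than \<open>v\<close>, listed in an arbitrary
  order: a configuration with \<open>b\<close> fragments occurs \<open>b!\<close> times.
\<close>

definition fragments :: "nat set \<Rightarrow> nat \<Rightarrow> nat list list set" where
  "fragments S v = {xss. [] \<notin> set xss \<and> distinct (concat xss) \<and> set (concat xss) = {1..v} \<and>
     (\<Union>xs\<in>set xss. peaks xs) = S \<inter> {1..v}}"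

definition nfragments :: "nat set \<Rightarrow> nat \<Rightarrow> nat \<Rightarrow> nat list list set" where
  "nfragments S v b = {xss \<in> fragments S v. length xss = b}"

lemma pinnacle_count_conv_nfragments:
  assumes "S \<subseteq> {1..n}" "n > 0"
  shows "pinnacle_count S n = card (nfragments S n 1)"
proof -
  let ?L = "{xs. distinct xs \<and> set xs = {1..n} \<and> peaks xs = S}"
  have restrict: "bij_betw f {x \<in> A. P (f x)} {y \<in> B. P y}" if "bij_betw f A B"
    for f :: "(nat \<Rightarrow> nat) \<Rightarrow> nat list" and A B P
    using that by (auto simp: bij_betw_def inj_on_def)
  have "bij_betw (\<lambda>w. map w [1..<Suc n]) {w. w permutes {1..n} \<and> Pin n w = S} ?L"
    using restrict[OF bij_betw_permutes_lists[of n], of "\<lambda>xs. peaks xs = S"]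
    by (simp add: Pin_conv_peaks conj_assoc del: upt_Suc)
  \<comment> \<open>A configuration with one fragment is the word itself; \<open>n > 0\<close> keeps
    this fragment nonempty.\<close>
  moreover have "nfragments S n 1 = (\<lambda>xs. [xs]) ` ?L"
    using assms by (auto simp: nfragments_def fragments_def length_Suc_conv Int_absorb2)
  ultimately show ?thesis
    by (simp add: pinnacle_count_def bij_betw_same_card card_image inj_on_def)
qed

text \<open>The filter discards empty remainders of the fragment around \<open>Suc v\<close>, so one
  equivalence covers starting, extending and joining fragments. Only joining has both sides
  nonempty, hence the test on \<open>Suc v \<in> S\<close>.\<close>

lemma fragments_insert_iff:
  "as @ (l @ Suc v # r) # bs \<in> fragments S (Suc v) \<longleftrightarrow>
   as @ filter (\<lambda>xs. xs \<noteq> []) [l, r] @ bs \<in> fragments S v \<and> (Suc v \<in> S \<longleftrightarrow> l \<noteq> [] \<and> r \<noteq> [])"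
proof -
  let ?new = "as @ (l @ Suc v # r) # bs" and ?old = "as @ filter (\<lambda>xs. xs \<noteq> []) [l, r] @ bs"
  have c: "set (concat ?new) = insert (Suc v) (set (concat ?old))"
    "distinct (concat ?new) \<longleftrightarrow> distinct (concat ?old) \<and> Suc v \<notin> set (concat ?old)"
    by auto
  have letters: "distinct (concat ?new) \<and> set (concat ?new) = {1..Suc v} \<longleftrightarrow>
      distinct (concat ?old) \<and> set (concat ?old) = {1..v}"
  proof -
    have "{1..Suc v} = insert (Suc v) {1..v}" "Suc v \<notin> {1..v}" by auto
    then show ?thesis unfolding c by (metis insert_ident)
  qed
  have pk: "(\<Union>xs\<in>set ?new. peaks xs) = S \<inter> {1..Suc v} \<longleftrightarrow>
      (\<Union>xs\<in>set ?old. peaks xs) = S \<inter> {1..v} \<and> (Suc v \<in> S \<longleftrightarrow> l \<noteq> [] \<and> r \<noteq> [])"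
    if old: "set (concat ?old) = {1..v}"
  proof -
    have "set l \<subseteq> {1..v}" "set r \<subseteq> {1..v}" unfolding old[symmetric] by auto
    then have "peaks (l @ Suc v # r) = peaks l \<union> peaks r \<union> (if l \<noteq> [] \<and> r \<noteq> [] then {Suc v} else {})"
      by (intro peaks_append_greater) auto
    then have new: "(\<Union>xs\<in>set ?new. peaks xs) =
        (\<Union>xs\<in>set ?old. peaks xs) \<union> (if l \<noteq> [] \<and> r \<noteq> [] then {Suc v} else {})"
      by auto
    have "(\<Union>xs\<in>set ?old. peaks xs) \<subseteq> set (concat ?old)"
      using peaks_subset by auto
    then have "Suc v \<notin> (\<Union>xs\<in>set ?old. peaks xs)"
      unfolding old by (meson Suc_n_not_le_n atLeastAtMost_iff subsetD)
    moreover have "S \<inter> {1..Suc v} = S \<inter> {1..v} \<union> (if Suc v \<in> S then {Suc v} else {})"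
      by (auto simp: le_Suc_eq)
    moreover have "P \<union> (if c then {x} else {}) = T \<union> (if s then {x} else {}) \<longleftrightarrow> P = T \<and> (s \<longleftrightarrow> c)"
      if "x \<notin> P" "x \<notin> T" for P T :: "nat set" and x c s
      using that by (cases c; cases s) (auto simp: insert_ident)
    ultimately show ?thesis unfolding new by (simp only: Int_iff atLeastAtMost_iff Suc_n_not_le_n simp_thms)
  qed
  have ne: "[] \<notin> set ?new \<longleftrightarrow> [] \<notin> set ?old" by auto
  \<comment> \<open>The peak conditions are compared under the letter condition \<open>C'\<close>,
    which bounds the letters of \<open>l\<close> and \<open>r\<close> by \<open>v\<close>.\<close>
  have conj_iff: "A \<and> B \<and> C \<and> D \<longleftrightarrow> (A' \<and> B' \<and> C' \<and> D') \<and> Q"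
    if "A \<longleftrightarrow> A'" "B \<and> C \<longleftrightarrow> B' \<and> C'" "C' \<Longrightarrow> D \<longleftrightarrow> D' \<and> Q" for A B C D A' B' C' D' Q
    using that by blast
  show ?thesis
    unfolding fragments_def mem_Collect_eq by (rule conj_iff[OF ne letters pk])
qed

section \<open>Counting the ways to insert the next letter\<close>

text \<open>The middle block holds the \<open>j\<close> adjacent fragments that the next letter
  absorbs; \<open>j\<close> will be 0, 1 or 2.\<close>

definition splittings :: "nat \<Rightarrow> 'a list set \<Rightarrow> ('a list \<times> 'a list \<times> 'a list) set" where
  "splittings j X = {(as, ms, bs). as @ ms @ bs \<in> X \<and> length ms = j}"

text \<open>A block is determined by its starting index, and a list of length \<open>m\<close> has
  \<open>m + 1 - j\<close> of them; truncated subtraction gives none for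
  \<open>j > m\<close>.\<close>

lemma bij_betw_splittings:
  assumes "\<forall>xs\<in>X. length xs = m"
  shows "bij_betw (\<lambda>(as, ms, bs). (as @ ms @ bs, length as)) (splittings j X) (X \<times> {..<Suc m - j})"
proof (rule bij_betw_byWitness[where f' = "\<lambda>(xs, i). (take i xs, take j (drop i xs), drop (i + j) xs)"])
  have cat: "take i xs @ take j (drop i xs) @ drop (i + j) xs = xs" for i and xs :: "'a list"
    by (metis add.commute append_take_drop_id drop_drop)
  show "(\<lambda>(as, ms, bs). (as @ ms @ bs, length as)) ` splittings j X \<subseteq> X \<times> {..<Suc m - j}"
    using assms by (fastforce simp: splittings_def)
  show "(\<lambda>(xs, i). (take i xs, take j (drop i xs), drop (i + j) xs)) ` (X \<times> {..<Suc m - j})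
      \<subseteq> splittings j X"
    using assms by (auto simp: splittings_def cat)
  show "\<forall>a\<in>X \<times> {..<Suc m - j}. (\<lambda>(as, ms, bs). (as @ ms @ bs, length as))
      ((\<lambda>(xs, i). (take i xs, take j (drop i xs), drop (i + j) xs)) a) = a"
    using assms by (auto simp: cat)
qed (auto simp: splittings_def)

lemma
  assumes "finite (nfragments S v m)"
  shows card_splittings: "card (splittings j (nfragments S v m)) = (Suc m - j) * card (nfragments S v m)"
    and finite_splittings: "finite (splittings j (nfragments S v m))"
proof -
  have *: "bij_betw (\<lambda>(as, ms, bs). (as @ ms @ bs, length as)) (splittings j (nfragments S v m))
      (nfragments S v m \<times> {..<Suc m - j})"
    by (rule bij_betw_splittings) (simp add: nfragments_def)
  show "card (splittings j (nfragments S v m)) = (Suc m - j) * card (nfragments S v m)"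
    using bij_betw_same_card[OF *] by (simp add: card_cartesian_product mult.commute)
  show "finite (splittings j (nfragments S v m))"
    using bij_betw_finite[OF *] assms by simp
qed

lemma nfragments_decomp:
  assumes "xss \<in> nfragments S (Suc v) b"
  obtains as l r bs where "xss = as @ (l @ Suc v # r) # bs" "b = Suc (length as + length bs)"
    "as @ filter (\<lambda>xs. xs \<noteq> []) [l, r] @ bs \<in> fragments S v" "Suc v \<in> S \<longleftrightarrow> l \<noteq> [] \<and> r \<noteq> []"
proof -
  have x: "xss \<in> fragments S (Suc v)" "length xss = b"
    using assms by (auto simp: nfragments_def)
  then have "Suc v \<in> set (concat xss)" by (simp add: fragments_def del: set_concat)
  then obtain xs where "xs \<in> set xss" "Suc v \<in> set xs" by auto
  then obtain as l r bs where eq: "xss = as @ (l @ Suc v # r) # bs" by (metis split_list)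
  show thesis
    using x that[OF eq] unfolding eq fragments_insert_iff by simp
qed

text \<open>Since \<open>v\<close> occurs only once, both decompositions must cut at this
  occurrence, first in the list of fragments and then inside the fragment.\<close>

lemma split_at_unique:
  assumes "as @ (l @ v # r) # bs = as' @ (l' @ v # r') # bs'"
    and "v \<notin> set (concat as) \<union> set l \<union> set r \<union> set (concat bs)"
  shows "as = as' \<and> l = l' \<and> r = r' \<and> bs = bs'"
proof -
  have "as = as' \<and> l @ v # r = l' @ v # r' \<and> bs = bs'"
    using assms
  proof (induction as arbitrary: as')
    case Nil
    then show ?case by (cases as') auto
  next
    case (Cons a as)
    then show ?case by (cases as') auto
  qed
  then show ?thesis using assms(2) append_Cons_eq_iff[of v l r l' r'] by auto
qed


text \<open>The flags tell the kinds of insertion apart: none true starts a fragment, one extends a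
  fragment at an end, two join fragments.\<close>

definition patterned :: "nat set \<Rightarrow> nat \<Rightarrow> nat \<Rightarrow> bool \<Rightarrow> bool \<Rightarrow> nat list list set" where
  "patterned S v b p q = {xss \<in> nfragments S (Suc v) b. \<exists>as l r bs. xss = as @ (l @ Suc v # r) # bs \<and>
     (l \<noteq> [] \<longleftrightarrow> p) \<and> (r \<noteq> [] \<longleftrightarrow> q)}"

lemma Suc_notin_fragments:
  assumes "xss \<in> fragments S v"
  shows "Suc v \<notin> set (concat xss)"
  using assms by (simp add: fragments_def del: set_concat)

lemma patterned_disjoint:
  assumes "(p, q) \<noteq> (p', q')"
  shows "patterned S v b p q \<inter> patterned S v b p' q' = {}"
proof -
  have "p = p' \<and> q = q'" if x: "xss \<in> patterned S v b p q" "xss \<in> patterned S v b p' q'" for xss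
  proof -
    obtain as l r bs where 1: "xss = as @ (l @ Suc v # r) # bs" "l \<noteq> [] \<longleftrightarrow> p" "r \<noteq> [] \<longleftrightarrow> q"
      "xss \<in> fragments S (Suc v)"
      using x(1) unfolding patterned_def nfragments_def by blast
    obtain as' l' r' bs' where 2: "xss = as' @ (l' @ Suc v # r') # bs'" "l' \<noteq> [] \<longleftrightarrow> p'" "r' \<noteq> [] \<longleftrightarrow> q'"
      using x(2) unfolding patterned_def by blast
    have "distinct (concat xss)" using 1(4) by (simp add: fragments_def)
    then have "l = l' \<and> r = r'"
      using split_at_unique[of as l "Suc v" r bs as' l' r' bs'] 1(1) 2(1) by auto
    then show ?thesis using 1 2 by simp
  qed
  then show ?thesis using assms by blast
qed

text \<open>With \<open>j\<close> the number of true flags, erasing \<open>Suc v\<close> turns its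
  fragment into \<open>j\<close> remainders and leaves \<open>c + j\<close> fragments. Conversely,
  such a list has \<open>Suc (c + j) - j = Suc c\<close> blocks of \<open>j\<close> adjacent
  fragments, and each can be glued around \<open>Suc v\<close> in the order of the list.\<close>

lemma
  assumes fin: "finite (nfragments S v (c + of_bool p + of_bool q))"
    and pq: "Suc v \<in> S \<longleftrightarrow> p \<and> q"
  shows card_patterned: "card (patterned S v (Suc c) p q) =
      Suc c * card (nfragments S v (c + of_bool p + of_bool q))"
    and finite_patterned: "finite (patterned S v (Suc c) p q)"
proof -
  define j :: nat where "j = of_bool p + of_bool q"
  \<comment> \<open>On a one-element block \<open>hd\<close> and \<open>last\<close> agree, so the
    same formulas serve either flag alone; on a pair they give the left and the right part.\<close>
  define L :: "nat list list \<Rightarrow> nat list" where "L = (\<lambda>ms. if p then hd ms else [])"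
  define R :: "nat list list \<Rightarrow> nat list" where "R = (\<lambda>ms. if q then last ms else [])"
  define f where "f = (\<lambda>(as, ms, bs). as @ (L ms @ Suc v # R ms) # bs)"
  let ?X = "splittings j (nfragments S v (c + j))"
  have LR: "filter (\<lambda>xs. xs \<noteq> []) [L ms, R ms] = ms \<and> (L ms \<noteq> [] \<longleftrightarrow> p) \<and> (R ms \<noteq> [] \<longleftrightarrow> q)"
    if "length ms = j" "[] \<notin> set ms" for ms
    using that by (cases p; cases q) (auto simp: L_def R_def j_def length_Suc_conv numeral_2_eq_2)
  have X: "length ms = j" "as @ ms @ bs \<in> fragments S v" "[] \<notin> set ms"
    "length as + length bs = c" "Suc v \<notin> set (concat (as @ ms @ bs))"
    if "(as, ms, bs) \<in> ?X" for as ms bs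
    using that Suc_notin_fragments[of "as @ ms @ bs" S v]
    by (auto simp: splittings_def nfragments_def fragments_def)
  have "inj_on f ?X"
  proof (rule inj_onI)
    fix t t' assume t: "t \<in> ?X" "t' \<in> ?X" "f t = f t'"
    obtain as ms bs as' ms' bs' where tt': "t = (as, ms, bs)" "t' = (as', ms', bs')"
      by (metis prod_cases3)
    then have a: "(as, ms, bs) \<in> ?X" and a': "(as', ms', bs') \<in> ?X" and eq: "f (as, ms, bs) = f (as', ms', bs')"
      using t by blast+
    have 1: "filter (\<lambda>xs. xs \<noteq> []) [L ms, R ms] = ms" and 2: "filter (\<lambda>xs. xs \<noteq> []) [L ms', R ms'] = ms'"
      using LR X(1,3) a a' by blast+
    have "set (L ms) \<union> set (R ms) \<subseteq> set (concat ms)"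
      by (subst (3) 1[symmetric]) auto
    then have "Suc v \<notin> set (concat as) \<union> set (L ms) \<union> set (R ms) \<union> set (concat bs)"
      using X(5)[OF a] unfolding concat_append set_append by blast
    then have "as = as' \<and> L ms = L ms' \<and> R ms = R ms' \<and> bs = bs'"
      using eq unfolding f_def prod.case by (intro split_at_unique)
    then show "t = t'" using 1 2 tt' by metis
  qed
  moreover have "f ` ?X = patterned S v (Suc c) p q"
  proof (intro equalityI subsetI)
    fix xss assume "xss \<in> f ` ?X"
    then obtain as ms bs where a: "(as, ms, bs) \<in> ?X" and xss: "xss = as @ (L ms @ Suc v # R ms) # bs"
      by (auto simp: f_def)
    have ms: "filter (\<lambda>xs. xs \<noteq> []) [L ms, R ms] = ms" "L ms \<noteq> [] \<longleftrightarrow> p" "R ms \<noteq> [] \<longleftrightarrow> q"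
      using LR X(1,3) a by blast+
    have "xss \<in> fragments S (Suc v)"
      unfolding xss fragments_insert_iff ms using X(2)[OF a] pq by simp
    then have "xss \<in> nfragments S (Suc v) (Suc c)"
      using X(4)[OF a] by (simp add: nfragments_def xss)
    then show "xss \<in> patterned S v (Suc c) p q"
      using ms(2,3) xss unfolding patterned_def by blast
  next
    fix xss assume a: "xss \<in> patterned S v (Suc c) p q"
    then obtain as l r bs where xss: "xss = as @ (l @ Suc v # r) # bs" "l \<noteq> [] \<longleftrightarrow> p" "r \<noteq> [] \<longleftrightarrow> q"
      and x: "xss \<in> fragments S (Suc v)" "length xss = Suc c"
      unfolding patterned_def nfragments_def by blast
    define ms where "ms = filter (\<lambda>xs. xs \<noteq> []) [l, r]"
    have "as @ ms @ bs \<in> fragments S v"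
      using x(1) unfolding xss(1) fragments_insert_iff ms_def by simp
    moreover have "length ms = j" "L ms = l" "R ms = r"
      using xss(2,3) by (auto simp: ms_def j_def L_def R_def)
    ultimately have "(as, ms, bs) \<in> ?X" "f (as, ms, bs) = xss"
      using x(2) xss(1) by (auto simp: splittings_def nfragments_def f_def)
    then show "xss \<in> f ` ?X" by force
  qed
  ultimately have "bij_betw f ?X (patterned S v (Suc c) p q)"
    by (simp add: bij_betw_def)
  moreover have "finite (nfragments S v (c + j))" using fin by (simp add: j_def add.assoc)
  ultimately show "card (patterned S v (Suc c) p q) =
      Suc c * card (nfragments S v (c + of_bool p + of_bool q))" "finite (patterned S v (Suc c) p q)"
    using card_splittings[of S v "c + j" j] finite_splittings[of S v "c + j" j]
    by (auto simp: bij_betw_same_card[symmetric] bij_betw_finite j_def add.assoc)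
qed

lemma nfragments_Suc_conv_patterned:
  "nfragments S (Suc v) b = (if Suc v \<in> S then patterned S v b True True
     else patterned S v b False False \<union> patterned S v b True False \<union> patterned S v b False True)"
proof -
  have "xss \<in> (if Suc v \<in> S then patterned S v b True True
     else patterned S v b False False \<union> patterned S v b True False \<union> patterned S v b False True)"
    if "xss \<in> nfragments S (Suc v) b" for xss
  proof -
    from that obtain as l r bs where d: "xss = as @ (l @ Suc v # r) # bs" "Suc v \<in> S \<longleftrightarrow> l \<noteq> [] \<and> r \<noteq> []"
      by (rule nfragments_decomp)
    then have "xss \<in> patterned S v b (l \<noteq> []) (r \<noteq> [])"
      using that unfolding patterned_def by blast
    then show ?thesis using d(2) by (cases "l = []"; cases "r = []") auto
  qed
  moreover have "patterned S v b p q \<subseteq> nfragments S (Suc v) b" for p q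
    by (auto simp: patterned_def)
  ultimately show ?thesis by (intro equalityI subsetI) (auto split: if_splits)
qed

section \<open>The recurrence for unordered configurations\<close>

definition grow :: "(nat \<Rightarrow> nat) \<Rightarrow> nat \<Rightarrow> nat" where
  "grow g b = (case b of 0 \<Rightarrow> 0 | Suc c \<Rightarrow> g c + 2 * b * g b)"

text \<open>Here \<open>b\<close> counts the fragments after the insertion: there were
  \<open>Suc b\<close> before, hence \<open>Suc b * b\<close> ordered pairs to join.\<close>

definition merge :: "(nat \<Rightarrow> nat) \<Rightarrow> nat \<Rightarrow> nat" where
  "merge g b = b * Suc b * g (Suc b)"

primrec fragment_count :: "nat set \<Rightarrow> nat \<Rightarrow> nat \<Rightarrow> nat" where
  "fragment_count S 0 = (\<lambda>b. of_bool (b = 0))"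
| "fragment_count S (Suc v) = (if Suc v \<in> S then merge else grow) (fragment_count S v)"

text \<open>The factor \<open>fact b\<close> orders the fragments. It turns the factor
  \<open>b\<close> of \<open>card_patterned\<close> into the weights of the operators:
  \<open>b * fact (b + 1) = fact b * (b * (b + 1))\<close> for joining,
  \<open>b * fact (b - 1) = fact b\<close> for starting, and \<open>b * fact b\<close> once for each
  end.\<close>

lemma card_nfragments:
  "finite (nfragments S v b) \<and> card (nfragments S v b) = fact b * fragment_count S v b"
proof (induction v arbitrary: b)
  case 0
  have "fragments S 0 = {[]}"
  proof (intro equalityI subsetI)
    fix xss assume "xss \<in> fragments S 0"
    then have "[] \<notin> set xss" "set (concat xss) = {}"
      unfolding fragments_def by simp_all
    then show "xss \<in> {[]}" by (cases xss) auto
  qed (simp add: fragments_def)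
  then have "nfragments S 0 b = (if b = 0 then {[]} else {})"
    by (auto simp: nfragments_def)
  then show ?case by simp
next
  case (Suc v)
  show ?case
  proof (cases b)
    case 0
    have "xss \<notin> nfragments S (Suc v) 0" for xss by (metis nat.distinct(1) nfragments_decomp)
    then have "nfragments S (Suc v) 0 = {}" by blast
    then show ?thesis using 0 by (simp add: grow_def merge_def)
  next
    case b: (Suc c)
    have fin: "finite (nfragments S v m)" for m using Suc.IH by blast
    have card: "card (nfragments S v m) = fact m * fragment_count S v m" for m using Suc.IH by blast
    show ?thesis
    proof (cases "Suc v \<in> S")
      case True
      then show ?thesis
        unfolding b nfragments_Suc_conv_patterned
        using card_patterned[of S v c True True] finite_patterned[of S v c True True] fin
        by (simp add: card merge_def algebra_simps)
    next
      case False
      let ?P = "patterned S v b"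
      have P: "finite (?P p q)" "card (?P p q) = b * card (nfragments S v (c + of_bool p + of_bool q))"
        if "\<not> (p \<and> q)" for p q
        using that card_patterned[of S v c p q] finite_patterned[of S v c p q] fin False
        unfolding b by auto
      have "finite (nfragments S (Suc v) b)"
        using False P(1) by (simp add: nfragments_Suc_conv_patterned)
      moreover have "card (nfragments S (Suc v) b) = card (?P False False \<union> ?P True False \<union> ?P False True)"
        using False by (simp add: nfragments_Suc_conv_patterned)
      moreover have "\<dots> = card (?P False False) + card (?P True False) + card (?P False True)"
        using P(1) by (simp add: card_Un_disjoint patterned_disjoint Int_Un_distrib2)
      ultimately show ?thesis
        using False P(2)[of False False] P(2)[of True False] P(2)[of False True]
        by (simp add: card b grow_def algebra_simps)
    qed
  qed
qed

lemma pinnacle_count_conv_fragment_count: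
  assumes "S \<subseteq> {1..n}" "n > 0"
  shows "pinnacle_count S n = fragment_count S n 1"
  using card_nfragments[of S n 1] by (simp add: pinnacle_count_conv_nfragments[OF assms])


section \<open>The upper bound and its attainment\<close>

lemma grow_0: "grow g 0 = 0"
  by (simp add: grow_def)

lemma grow_Suc: "grow g (Suc c) = g c + 2 * Suc c * g (Suc c)"
  by (simp add: grow_def)

lemma grow_mono: "g \<le> h \<Longrightarrow> grow g \<le> grow h"
  by (auto simp: le_fun_def grow_def intro!: add_mono mult_left_mono split: nat.split)

lemma merge_mono: "g \<le> h \<Longrightarrow> merge g \<le> merge h"
  by (auto simp: le_fun_def merge_def intro!: mult_left_mono)

lemma funpow_merge_mono: "g \<le> h \<Longrightarrow> (merge ^^ k) g \<le> (merge ^^ k) h"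
  by (induction k) (simp_all add: merge_mono)

text \<open>For \<open>b > 0\<close> the right side exceeds the left by
  \<open>2 * b * g b + 2 * b * (b + 1) * g (b + 1)\<close>; at \<open>b = 0\<close> both
  vanish.\<close>

lemma grow_merge_le: "grow (merge g) \<le> merge (grow g)"
proof (rule le_funI)
  fix b
  show "grow (merge g) b \<le> merge (grow g) b"
    by (cases b) (simp_all add: grow_def merge_def algebra_simps)
qed

lemma grow_funpow_merge_le: "grow ((merge ^^ k) g) \<le> (merge ^^ k) (grow g)"
proof (induction k)
  case (Suc k)
  have "grow (merge ((merge ^^ k) g)) \<le> merge (grow ((merge ^^ k) g))" by (rule grow_merge_le)
  also have "\<dots> \<le> merge ((merge ^^ k) (grow g))" using Suc.IH by (rule merge_mono)
  finally show ?case by simp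
qed simp

lemma card_Int_Suc:
  "card (S \<inter> {Suc 0..Suc v}) = card (S \<inter> {Suc 0..v}) + of_bool (Suc v \<in> S)"
proof -
  have "S \<inter> {Suc 0..Suc v} = S \<inter> {Suc 0..v} \<union> (if Suc v \<in> S then {Suc v} else {})"
    by (auto simp: le_Suc_eq)
  then show ?thesis by simp
qed

lemma card_Int_le: "card (S \<inter> {1..v}) \<le> v"
  using card_mono[of "{1..v}" "S \<inter> {1..v}"] by simp

text \<open>The \<open>grow\<close> of each letter outside \<open>S\<close> is moved inwards past
  all earlier merges, which can only enlarge the state.\<close>

lemma fragment_count_le:
  "fragment_count S v \<le> (merge ^^ card (S \<inter> {1..v})) ((grow ^^ (v - card (S \<inter> {1..v}))) (fragment_count {} 0))"
proof (induction v)
  case (Suc v)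
  let ?k = "card (S \<inter> {1..v})" and ?\<delta> = "fragment_count {} 0"
  show ?case
  proof (cases "Suc v \<in> S")
    case True
    then show ?thesis using merge_mono[OF Suc.IH] by (simp add: card_Int_Suc)
  next
    case False
    have "grow (fragment_count S v) \<le> grow ((merge ^^ ?k) ((grow ^^ (v - ?k)) ?\<delta>))"
      using Suc.IH by (rule grow_mono)
    also have "\<dots> \<le> (merge ^^ ?k) (grow ((grow ^^ (v - ?k)) ?\<delta>))"
      by (rule grow_funpow_merge_le)
    also have "grow ((grow ^^ (v - ?k)) ?\<delta>) = (grow ^^ (Suc v - ?k)) ?\<delta>"
      using card_Int_le[of S v] by (simp add: Suc_diff_le)
    finally show ?thesis using False by (simp add: card_Int_Suc)
  qed
qed simp

text \<open>Without the 2 in its weight, \<open>grow\<close> is the Stirling recurrence. Of the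
  \<open>m\<close> letters \<open>b\<close> start a fragment, and each of the other
  \<open>m - b\<close> chooses one of two ends.\<close>

lemma funpow_grow_conv_Stirling: "(grow ^^ m) (fragment_count {} 0) b = 2 ^ (m - b) * Stirling m b"
proof (induction m arbitrary: b)
  case 0
  then show ?case by (cases b) auto
next
  case (Suc m)
  show ?case
  proof (cases b)
    case b: (Suc c)
    \<comment> \<open>For \<open>m \<le> c\<close> both truncated exponents are 0, and the equation
      holds because the Stirling number vanishes.\<close>
    have pow: "2 * (2 ^ (m - Suc c) * Stirling m (Suc c)) = 2 ^ (m - c) * Stirling m (Suc c)"
    proof (cases "c < m")
      case True
      then have "m - c = Suc (m - Suc c)" by simp
      then show ?thesis by simp
    qed simp
    have "(grow ^^ Suc m) (fragment_count {} 0) b =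
        2 ^ (m - c) * Stirling m c + Suc c * (2 * (2 ^ (m - Suc c) * Stirling m (Suc c)))"
      by (simp add: b grow_Suc Suc.IH del: fragment_count.simps(1))
    also have "\<dots> = 2 ^ (Suc m - b) * Stirling (Suc m) b"
      unfolding pow b by (simp add: algebra_simps)
    finally show ?thesis .
  qed (simp add: grow_0)
qed

text \<open>Joining \<open>k + 1\<close> fragments into one multiplies by \<open>j * (j + 1)\<close>
  for \<open>j = 1, ..., k\<close>.\<close>

lemma funpow_merge_1: "(merge ^^ k) g 1 = fact k * fact (k + 1) * g (k + 1)"
proof (induction k arbitrary: g)
  case (Suc k)
  \<comment> \<open>The innermost \<open>merge\<close> is split off, so that the induction
    hypothesis applies at 1 to the state \<open>merge g\<close>.\<close>
  have "(merge ^^ Suc k) g 1 = (merge ^^ k) (merge g) 1"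
    by (simp only: funpow_Suc_right o_apply)
  also have "\<dots> = fact k * fact (k + 1) * merge g (k + 1)" by (rule Suc.IH)
  also have "\<dots> = fact (Suc k) * fact (Suc k + 1) * g (Suc k + 1)"
    unfolding merge_def[of g "k + 1"] by (simp del: mult_Suc mult_Suc_right)
  finally show ?case .
qed simp

lemma funpow_merge_grow_1:
  "(merge ^^ d) ((grow ^^ (n - d)) (fragment_count {} 0)) 1 =
     fact d * fact (d + 1) * 2 ^ (n - 2 * d - 1) * Stirling (n - d) (d + 1)"
proof -
  have "n - d - (d + 1) = n - 2 * d - 1" by simp
  then show ?thesis
    unfolding funpow_merge_1 funpow_grow_conv_Stirling by (simp only: mult.assoc)
qed

lemma Stirling_pos: "0 < k \<Longrightarrow> k \<le> m \<Longrightarrow> 0 < Stirling m k"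
proof (induction m arbitrary: k)
  case (Suc m)
  show ?case
  proof (cases k)
    case (Suc j)
    then show ?thesis
      using Suc.IH[of k] Suc.IH[of j] Suc.prems by (cases "k \<le> m"; cases "j = 0") (auto simp: le_Suc_eq)
  qed (use Suc.prems in simp)
qed simp

lemma fragment_count_disjoint:
  assumes "S \<inter> {1..v} = {}"
  shows "fragment_count S v = (grow ^^ v) (fragment_count {} 0)"
  using assms
proof (induction v)
  case (Suc v)
  then have "S \<inter> {1..v} = {}" "Suc v \<notin> S" by auto
  then show ?case using Suc.IH by simp
qed simp

text \<open>When the \<open>d\<close> largest letters are the pinnacles, no \<open>grow\<close>
  follows a \<open>merge\<close>, so nothing is lost by reordering.\<close>

lemma fragment_count_greatest:
  assumes "d < n"
  shows "fragment_count {n - d + 1..n} n = (merge ^^ d) ((grow ^^ (n - d)) (fragment_count {} 0))"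
proof -
  let ?S = "{n - d + 1..n}"
  have "fragment_count ?S (n - d + k) = (merge ^^ k) ((grow ^^ (n - d)) (fragment_count {} 0))"
    if "k \<le> d" for k
    using that
  proof (induction k)
    case 0
    show ?case using fragment_count_disjoint[of ?S "n - d"] by (simp del: fragment_count.simps(1))
  next
    case (Suc k)
    then have "Suc (n - d + k) \<in> ?S" using assms by auto
    then show ?case using Suc by simp
  qed
  from this[of d] show ?thesis using assms by simp
qed

section \<open>The ballot condition for admissible sets\<close>

text \<open>A pinnacle lowers the number of fragments by one, and any other letter raises it by at
  most one.\<close>

lemma fragment_count_nonzeroD:
  "fragment_count S v b \<noteq> 0 \<Longrightarrow> 2 * card (S \<inter> {1..v}) + b \<le> v \<and> (v > 0 \<longrightarrow> b > 0)"
proof (induction v arbitrary: b)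
  case (Suc v)
  show ?case
  proof (cases "Suc v \<in> S")
    case True
    then have "fragment_count S v (Suc b) \<noteq> 0" "b > 0" using Suc.prems by (auto simp: merge_def)
    then show ?thesis using Suc.IH[of "Suc b"] True by (simp add: card_Int_Suc)
  next
    case False
    with Suc.prems obtain c where "b = Suc c" "fragment_count S v c \<noteq> 0 \<or> fragment_count S v b \<noteq> 0"
      by (auto simp: grow_def split: nat.splits)
    then show ?thesis using Suc.IH[of c] Suc.IH[of b] False by (auto simp: card_Int_Suc)
  qed
qed (simp split: if_splits)

lemma fragment_count_nonzero_earlier:
  "fragment_count S (v + m) b \<noteq> 0 \<Longrightarrow> \<exists>c. fragment_count S v c \<noteq> 0"
proof (induction m arbitrary: b)
  case (Suc m)
  then have "\<exists>c. fragment_count S (v + m) c \<noteq> 0"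
    by (auto simp: grow_def merge_def split: nat.splits if_splits)
  then show ?case using Suc.IH by blast
qed auto

lemma Pin_subset:
  assumes "w permutes {1..k}"
  shows "Pin k w \<subseteq> {1..k}"
  using permutes_in_image[OF assms] by (fastforce simp: Pin_def)

text \<open>The letters up to \<open>v\<close> of a realizing word form at least one fragment, so
  the bound on nonzero entries holds with \<open>b > 0\<close>. The length of that word, which may
  differ from the \<open>n\<close> of the theorem, is gone from the conclusion.\<close>

lemma admissible_ballot:
  assumes "admissible_pinnacle_set S" "v > 0"
  shows "2 * card (S \<inter> {1..v}) < v"
proof -
  obtain k w where k: "k \<ge> 1" and w: "w permutes {1..k}" "Pin k w = S"
    using assms(1) by (auto simp: admissible_pinnacle_set_def)
  have S: "S \<subseteq> {1..k}" using Pin_subset[OF w(1)] w(2) by simp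
  have "finite {w. w permutes {1..k} \<and> Pin k w = S}"
    by (rule finite_subset[OF _ finite_permutations[of "{1..k}"]]) auto
  then have "pinnacle_count S k \<noteq> 0" using w by (auto simp: pinnacle_count_def)
  then have fc: "fragment_count S k 1 \<noteq> 0"
    using pinnacle_count_conv_fragment_count[OF S] k by simp
  show ?thesis
  proof (cases "v \<le> k")
    case True
    then obtain c where "fragment_count S v c \<noteq> 0"
      using fragment_count_nonzero_earlier[of S v "k - v" 1] fc by auto
    then show ?thesis using fragment_count_nonzeroD[of S v c] assms(2) by linarith
  next
    \<comment> \<open>Beyond \<open>k\<close> the set gains no elements while \<open>v\<close> still
      grows.\<close>
    case False
    then have "S \<inter> {1..v} = S \<inter> {1..k}" using S by auto
    then show ?thesis using fragment_count_nonzeroD[OF fc] False by simp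
  qed
qed

section \<open>The lower bound and its attainment\<close>

text \<open>Each step keeps a single summand. If the exponent grows by one, the weight
  \<open>b * (b + 1)\<close> or \<open>2 * b\<close> supplies the factor 2; starting a fragment has
  weight 1 and leaves the exponent unchanged.\<close>

lemma fragment_count_ge:
  assumes ballot: "\<And>v. v > 0 \<Longrightarrow> 2 * card (S \<inter> {1..v}) < v"
  shows "v > 0 \<Longrightarrow> b > 0 \<Longrightarrow> 2 * card (S \<inter> {1..v}) + b \<le> v \<Longrightarrow>
    2 ^ (v - card (S \<inter> {1..v}) - b) \<le> fragment_count S v b"
proof (induction v arbitrary: b)
  case (Suc v)
  let ?k = "card (S \<inter> {1..v})"
  show ?case
  proof (cases "Suc v \<in> S")
    case True
    \<comment> \<open>The ballot condition at 1 excludes 1 from \<open>S\<close>.\<close>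
    have "v > 0"
      using ballot[of "Suc v"] True by (cases v) (auto simp: card_Int_Suc)
    then have IH: "2 ^ (v - ?k - Suc b) \<le> fragment_count S v (Suc b)"
      using Suc.IH[of "Suc b"] Suc.prems True by (simp add: card_Int_Suc)
    have "Suc v - card (S \<inter> {1..Suc v}) - b = Suc (v - ?k - Suc b)"
      using Suc.prems True by (simp add: card_Int_Suc)
    then have "2 ^ (Suc v - card (S \<inter> {1..Suc v}) - b) = 2 * 2 ^ (v - ?k - Suc b)" by simp
    also have "\<dots> \<le> (b * Suc b) * fragment_count S v (Suc b)"
    proof (rule mult_mono[OF _ IH])
      show "2 \<le> b * Suc b" using mult_le_mono[of 1 b 2 "Suc b"] Suc.prems(2) by simp
    qed simp_all
    finally show ?thesis using True by (simp add: merge_def)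
  next
    case False
    obtain c where c: "b = Suc c" using Suc.prems(2) by (cases b) auto
    have k: "card (S \<inter> {1..Suc v}) = ?k" using False by (simp add: card_Int_Suc)
    consider "v = 0" | "v > 0" "2 * ?k + b \<le> v" | "v > 0" "2 * ?k + b = Suc v"
      using Suc.prems k by linarith
    then show ?thesis
    proof cases
      case 1
      then show ?thesis using Suc.prems c False by (simp add: grow_def)
    next
      case 2
      have "Suc v - ?k - b = Suc (v - ?k - b)" using 2 by simp
      then have "2 ^ (Suc v - ?k - b) = 2 * 2 ^ (v - ?k - b)" by simp
      also have "\<dots> \<le> 2 * b * fragment_count S v b"
        using Suc.IH[of b] 2 Suc.prems(2) by (intro mult_mono) auto
      finally show ?thesis using False unfolding k by (simp add: grow_def c)
    next
      case 3
      \<comment> \<open>Now \<open>b\<close> is too large for the induction hypothesis, so the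
        summand \<open>g c\<close> must serve; the ballot condition at \<open>v\<close> gives
        \<open>b \<ge> 2\<close>.\<close>
      then have "c > 0" using ballot[of v] c by simp
      then have "2 ^ (v - ?k - c) \<le> fragment_count S v c" using Suc.IH[of c] 3 c by simp
      then show ?thesis using False c unfolding k by (simp add: grow_def trans_le_add1)
    qed
  qed
qed simp

text \<open>After each odd letter up to \<open>2 * d + 1\<close> only one fragment can remain. From
  the value \<open>2 ^ i\<close> at 1, \<open>grow\<close> gives \<open>2 ^ i\<close> at 2, and
  \<open>merge\<close> doubles this back into the entry 1. Each of the last \<open>m\<close> letters
  doubles that entry.\<close>

lemma fragment_count_odd:
  assumes S: "S = (\<lambda>i. 2 * i + 1) ` {1..d}"
  shows "fragment_count S (2 * d + 1 + m) 1 = 2 ^ (d + m)"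
proof -
  have mem: "2 * i + 3 \<in> S \<longleftrightarrow> i < d" "2 * i + 2 \<notin> S" for i
  proof -
    have "2 * i + 3 = (\<lambda>i. 2 * i + 1) (Suc i)" by simp
    then have "2 * i + 3 \<in> S \<longleftrightarrow> Suc i \<in> {1..d}"
      unfolding S by (metis (no_types, lifting) add_right_cancel image_iff mult_left_cancel zero_neq_numeral)
    then show "2 * i + 3 \<in> S \<longleftrightarrow> i < d" by auto
    show "2 * i + 2 \<notin> S" unfolding S by (auto, presburger)
  qed
  have low: "fragment_count S (2 * i + 1) = (\<lambda>b. if b = 1 then 2 ^ i else 0)" if "i \<le> d" for i
    using that
  proof (induction i)
    case 0
    have "Suc 0 \<notin> S" unfolding S by auto
    then show ?case by (auto simp: fun_eq_iff grow_def split: nat.split)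
  next
    case (Suc i)
    have *: "2 * Suc i + 1 = Suc (Suc (2 * i + 1))" by simp
    have "Suc (2 * i + 1) \<notin> S" "Suc (Suc (2 * i + 1)) \<in> S"
      using mem[of i] Suc.prems by (simp_all add: eval_nat_numeral)
    then have "fragment_count S (2 * Suc i + 1) = merge (grow (fragment_count S (2 * i + 1)))"
      unfolding * by simp
    then show ?case using Suc by (auto simp: fun_eq_iff merge_def grow_def split: nat.split)
  qed
  \<comment> \<open>The entry at 0 is carried along because \<open>grow\<close> adds it to the entry
    at 1.\<close>
  have "fragment_count S (2 * d + 1 + m) 0 = 0 \<and> fragment_count S (2 * d + 1 + m) 1 = 2 ^ (d + m)"
  proof (induction m)
    case 0
    then show ?case using low[of d] by simp
  next
    case (Suc m)
    have "Suc (2 * d + 1 + m) \<notin> S" unfolding S by auto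
    then show ?case using Suc by (simp add: grow_def)
  qed
  then show ?thesis by simp
qed

lemma admissible_if_pinnacle_count_pos:
  assumes "pinnacle_count S n > 0" "n > 0"
  shows "admissible_pinnacle_set S"
proof -
  have "{w. w permutes {1..n} \<and> Pin n w = S} \<noteq> {}"
    using assms(1) by (metis card.empty less_irrefl pinnacle_count_def)
  then show ?thesis using assms(2) by (auto simp: admissible_pinnacle_set_def Suc_le_eq)
qed

theorem theorem1p9:
  fixes d n :: nat
  assumes "d > 0" and "n > 0" and "2 * d < n"
  shows "(\<forall>S. admissible_pinnacle_set S \<and> S \<subseteq> {1..n} \<and> card S = d \<longrightarrow>
             2 ^ (n - d - 1) \<le> pinnacle_count S n \<and>
             pinnacle_count S n \<le>
               fact d * fact (d + 1) * 2 ^ (n - 2 * d - 1) * Stirling (n - d) (d + 1)) \<and>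
         (\<exists>S. admissible_pinnacle_set S \<and> S \<subseteq> {1..n} \<and> card S = d \<and>
             pinnacle_count S n =
               fact d * fact (d + 1) * 2 ^ (n - 2 * d - 1) * Stirling (n - d) (d + 1)) \<and>
         (\<exists>S. admissible_pinnacle_set S \<and> S \<subseteq> {1..n} \<and> card S = d \<and>
             pinnacle_count S n = 2 ^ (n - d - 1))"
proof (intro conjI allI impI; (elim conjE)?)
  fix S assume S: "admissible_pinnacle_set S" "S \<subseteq> {1..n}" "card S = d"
  have Int: "S \<inter> {1..n} = S" using S(2) by blast
  note count = pinnacle_count_conv_fragment_count[OF S(2) assms(2)]
  \<comment> \<open>One fragment at \<open>v = n\<close> has exponent \<open>n - d - 1\<close>, and
    \<open>2 * d < n\<close> is the required room for it.\<close>
  show "2 ^ (n - d - 1) \<le> pinnacle_count S n"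
    using fragment_count_ge[of S n 1] admissible_ballot[OF S(1)] assms S(3)
    unfolding count Int by simp
  show "pinnacle_count S n \<le> fact d * fact (d + 1) * 2 ^ (n - 2 * d - 1) * Stirling (n - d) (d + 1)"
    using le_funD[OF fragment_count_le[of S n], of 1]
    unfolding count Int S(3) funpow_merge_grow_1 .
next
  let ?S = "{n - d + 1..n}"
  have sub: "?S \<subseteq> {1..n}" by auto
  have count: "pinnacle_count ?S n =
      fact d * fact (d + 1) * 2 ^ (n - 2 * d - 1) * Stirling (n - d) (d + 1)"
    using fragment_count_greatest[of d n] assms(3)
    unfolding pinnacle_count_conv_fragment_count[OF sub assms(2)] funpow_merge_grow_1[symmetric] by simp
  \<comment> \<open>A positive count yields a word of length \<open>n\<close> that realizes the set,
    hence admissibility.\<close>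
  moreover have "0 < Stirling (n - d) (d + 1)" using assms(3) by (intro Stirling_pos) auto
  ultimately have "admissible_pinnacle_set ?S"
    using assms(2) by (intro admissible_if_pinnacle_count_pos[of _ n]) simp_all
  moreover have "card ?S = d" using assms(3) by simp
  ultimately show "\<exists>S. admissible_pinnacle_set S \<and> S \<subseteq> {1..n} \<and> card S = d \<and>
      pinnacle_count S n = fact d * fact (d + 1) * 2 ^ (n - 2 * d - 1) * Stirling (n - d) (d + 1)"
    using sub count by blast
next
  let ?S = "(\<lambda>i. 2 * i + 1) ` {1..d}"
  have sub: "?S \<subseteq> {1..n}" using assms(3) by auto
  \<comment> \<open>\<open>m\<close> is the number of letters above the largest pinnacle
    \<open>2 * d + 1\<close>.\<close>
  obtain m where n: "n = 2 * d + 1 + m"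
    using less_imp_Suc_add[OF assms(3)] by auto
  have count: "pinnacle_count ?S n = 2 ^ (n - d - 1)"
    unfolding pinnacle_count_conv_fragment_count[OF sub assms(2)]
    using fragment_count_odd[OF refl, of d m] by (simp add: n)
  then have "admissible_pinnacle_set ?S"
    using assms(2) by (intro admissible_if_pinnacle_count_pos[of _ n]) simp_all
  moreover have "card ?S = d" by (simp add: card_image inj_on_def)
  ultimately show "\<exists>S. admissible_pinnacle_set S \<and> S \<subseteq> {1..n} \<and> card S = d \<and>
      pinnacle_count S n = 2 ^ (n - d - 1)"
    using sub count by blast
qed

end
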